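(* Let $n$ be a positive integer and let $h, j > 0$ be parameters with $h \le n^{1/4}/\sqrt{\log n}$ and $j \le \sqrt{h}$. Consider a frontyard/backyard hash table that can hold up to $n$ items, whose front yard consists of $m = n/h$ bins, each of capacity $h + j\sqrt{h+1} + 1$. Each item $x$ is assigned a bin $H(x)$ chosen uniformly at random (independently across items). When an item $x$ is inserted, if bin $H(x)$ has room the item is placed into bin $H(x)$, and if bin $H(x)$ is full the item is placed into the backyard; items are never moved once placed, and a deleted item is simply removed from wherever it is stored. Consider any sequence of $\mathrm{poly}(m)$ insertions and deletions (fixed independently of the random hash values) such that the table never contains more than $n$ items. Then, with probability $1 - 1/\mathrm{poly}(n)$, at every moment during this sequence the number of items in the backyard is $O\!\left(n / 2^{\Omega(j^2)} + n^{3/4}\sqrt{\log n}\right)$.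
   Context: The "front yard" is an array of $m$ bins (buckets) of fixed capacity; the "backyard" is an auxiliary structure of unbounded capacity that receives exactly those inserted items whose front-yard bin was full at the time of their insertion. Here $\mathrm{poly}(\cdot)$ denotes a polynomial, and "with probability $1-1/\mathrm{poly}(n)$" means for any desired constant exponent, with suitable constants in the $O$ and $\Omega$. *)

theory Defs
  imports "HOL-Probability.Probability"
begin

datatype hop = Ins nat | Del nat

fun hop_item :: "hop \<Rightarrow> nat" where
  "hop_item (Ins x) = x"
| "hop_item (Del x) = x"

text \<open>State: (front yard items, backyard items). The bin of item y is H y.
  An inserted item goes to bin H x if that bin currently holds fewer than cap
  items, otherwise to the backyard. Items are never moved; deletions remove.\<close>
fun fb_step :: "(nat \<Rightarrow> nat) \<Rightarrow> real \<Rightarrow> nat set \<times> nat set \<Rightarrow> hop \<Rightarrow> nat set \<times> nat set" where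
  "fb_step H cap (F, B) (Ins x) =
     (if real (card {y \<in> F. H y = H x}) < cap then (insert x F, B) else (F, insert x B))"
| "fb_step H cap (F, B) (Del x) = (F - {x}, B - {x})"

definition fb_run :: "(nat \<Rightarrow> nat) \<Rightarrow> real \<Rightarrow> hop list \<Rightarrow> nat set \<times> nat set" where
  "fb_run H cap ops = foldl (fb_step H cap) ({}, {}) ops"

definition backyard_size :: "(nat \<Rightarrow> nat) \<Rightarrow> real \<Rightarrow> hop list \<Rightarrow> nat" where
  "backyard_size H cap ops = card (snd (fb_run H cap ops))"

fun pres_step :: "nat set \<Rightarrow> hop \<Rightarrow> nat set" where
  "pres_step S (Ins x) = insert x S"
| "pres_step S (Del x) = S - {x}"

definition present :: "hop list \<Rightarrow> nat set" where
  "present ops = foldl pres_step {} ops"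

definition valid_seq :: "nat \<Rightarrow> hop list \<Rightarrow> bool" where
  "valid_seq n ops \<longleftrightarrow>
     (\<forall>k < length ops. case ops ! k of
         Ins x \<Rightarrow> x \<notin> present (take k ops)
       | Del x \<Rightarrow> x \<in> present (take k ops)) \<and>
     (\<forall>k \<le> length ops. card (present (take k ops)) \<le> n)"

definition hash_pmf :: "nat \<Rightarrow> hop list \<Rightarrow> (nat \<Rightarrow> nat) pmf" where
  "hash_pmf m ops = Pi_pmf (hop_item ` set ops) 0 (\<lambda>_. pmf_of_set {..<m})"

end

theory Submission
  imports Defs
begin

text \<open>Let \<open>S\<close> be the set of items present at a given time. An item \<open>x \<in> S\<close> is in the backyard only if
  at least \<open>cap\<close> of the items that were present at its last insertion share its bin. The number
  \<open>Y b\<close> of such \<open>x\<close> in bin \<open>b\<close> is a monotone function of the set of all items hashed to \<open>b\<close>.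
  These occupancy sets are negatively associated, so the exponential moment of the sum of the
  \<open>Y b\<close> is at most the product of the individual ones, each computed for a random set
  containing every item independently with probability \<open>1 / m\<close>; the deleted items thus cost
  nothing, however many there are. At scale \<open>\<mu> = 1 / (2 h)\<close> the bound
  \<open>exp (\<mu> Y) \<le> 1 + \<mu> Y exp (\<mu> s)\<close>, with \<open>s\<close> the number of items of \<open>S\<close> in the bin, loses only a
  constant factor, and bounding the indicator of a full bin by an exponential with parameter
  \<open>\<theta> = j / (2 sqrt h)\<close> gives the factor \<open>exp (- j\<^sup>2 / 4)\<close>. Markov's inequality then yields a tail of
  \<open>exp (- \<Omega>(D / h))\<close> for a deviation \<open>D\<close>, which is superpolynomially small for
  \<open>D = n powr (3/4) * sqrt (ln n)\<close>, and a union bound over all times concludes. For \<open>h < 1\<close>, where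
  \<open>m\<close> is not bounded by \<open>n\<close>, the claimed bound exceeds \<open>n\<close> and holds trivially.\<close>

section \<open>Operation sequences and witnesses for backyard items\<close>

lemma finite_present: "finite (present ops)"
proof (induction ops rule: rev_induct)
  case (snoc a ops)
  then show ?case by (cases a) (auto simp: present_def)
qed (simp add: present_def)

lemma present_subset_items: "present ops \<subseteq> hop_item ` set ops"
proof (induction ops rule: rev_induct)
  case (snoc a ops)
  then show ?case by (cases a) (auto simp: present_def)
qed (simp add: present_def)

lemma present_snoc: "present (ops @ [a]) = pres_step (present ops) a"
  by (simp add: present_def)

lemma fb_run_snoc: "fb_run H cap (ops @ [a]) = fb_step H cap (fb_run H cap ops) a"
  by (simp add: fb_run_def)

lemma valid_seq_snocD:
  assumes "valid_seq n (ops @ [a])"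
  shows "valid_seq n ops" "card (present ops) \<le> n"
    "case a of Ins x \<Rightarrow> x \<notin> present ops | Del x \<Rightarrow> x \<in> present ops"
proof -
  have 1: "\<forall>k<Suc (length ops). case (ops @ [a]) ! k of Ins x \<Rightarrow> x \<notin> present (take k (ops @ [a]))
       | Del x \<Rightarrow> x \<in> present (take k (ops @ [a]))"
   and 2: "\<forall>k\<le>Suc (length ops). card (present (take k (ops @ [a]))) \<le> n"
    using assms unfolding valid_seq_def by auto
  show "case a of Ins x \<Rightarrow> x \<notin> present ops | Del x \<Rightarrow> x \<in> present ops"
    using 1[rule_format, of "length ops"] by (cases a) auto
  show "card (present ops) \<le> n"
    using 2[rule_format, of "length ops"] by simp
  show "valid_seq n ops"
    unfolding valid_seq_def
  proof (intro conjI allI impI)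
    fix k assume "k < length ops"
    then show "case ops ! k of Ins x \<Rightarrow> x \<notin> present (take k ops) | Del x \<Rightarrow> x \<in> present (take k ops)"
      using 1[rule_format, of k] by (simp add: nth_append split: hop.splits)
  next
    fix k assume "k \<le> length ops"
    then show "card (present (take k ops)) \<le> n"
      using 2[rule_format, of k] by simp
  qed
qed

lemma valid_seq_take: "valid_seq n ops \<Longrightarrow> valid_seq n (take k ops)"
  unfolding valid_seq_def by (auto simp: min_def split: if_splits hop.splits)

lemma card_present_le: "valid_seq n ops \<Longrightarrow> card (present ops) \<le> n"
  unfolding valid_seq_def by (metis order_refl take_all)

text \<open>\<open>P x\<close> is the set of items present just before the last insertion of \<open>x\<close>.\<close>
lemma backyard_witness_sets:
  assumes "valid_seq n ops"
  shows "\<exists>P. (\<forall>x\<in>present ops. x \<notin> P x \<and> card (P x) \<le> n \<and> P x \<subseteq> hop_item ` set ops) \<and>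
    (\<forall>H. fst (fb_run H cap ops) \<subseteq> present ops \<and>
       snd (fb_run H cap ops) \<subseteq> {x \<in> present ops. cap \<le> real (card {y \<in> P x. H y = H x})})"
  using assms
proof (induction ops rule: rev_induct)
  case Nil
  show ?case by (auto simp: present_def fb_run_def)
next
  case (snoc a ops)
  note v = valid_seq_snocD[OF snoc.prems]
  obtain P where P1: "\<And>x. x \<in> present ops \<Longrightarrow> x \<notin> P x \<and> card (P x) \<le> n \<and> P x \<subseteq> hop_item ` set ops"
    and F: "\<And>H. fst (fb_run H cap ops) \<subseteq> present ops"
    and B: "\<And>H. snd (fb_run H cap ops) \<subseteq> {x \<in> present ops. cap \<le> real (card {y \<in> P x. H y = H x})}"
    using snoc.IH[OF v(1)] by blast
  show ?case
  proof (cases a)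
    case (Ins x)
    then have x: "x \<notin> present ops" using v(3) by simp
    \<comment> \<open>Any earlier witness of \<open>x\<close> is overwritten; the new one omits
      \<open>x\<close> because a valid sequence inserts only absent items.\<close>
    define Q where "Q = P(x := present ops)"
    have Q: "y \<notin> Q y \<and> card (Q y) \<le> n \<and> Q y \<subseteq> hop_item ` set (ops @ [a])"
      if "y \<in> present (ops @ [a])" for y
      using that P1[of y] x v(2) present_subset_items[of ops]
      by (auto simp: Q_def present_snoc Ins)
    have "fst (fb_run H cap (ops @ [a])) \<subseteq> present (ops @ [a]) \<and>
       snd (fb_run H cap (ops @ [a])) \<subseteq>
         {y \<in> present (ops @ [a]). cap \<le> real (card {z \<in> Q y. H z = H y})}" for H
    proof -
      obtain F' B' where FB: "fb_run H cap ops = (F', B')" by (cases "fb_run H cap ops")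
      have F': "F' \<subseteq> present ops" using F[of H] FB by simp
      \<comment> \<open>The front yard \<open>F'\<close> depends on \<open>H\<close>; bounding it by
        the present items gives a witness set that does not.\<close>
      have "cap \<le> real (card {y \<in> F'. H y = H x}) \<Longrightarrow> cap \<le> real (card {y \<in> present ops. H y = H x})"
        using card_mono[of "{y \<in> present ops. H y = H x}" "{y \<in> F'. H y = H x}"] F' finite_present[of ops]
        by fastforce
      then show ?thesis
        using F' B[of H] x unfolding FB fb_run_snoc present_snoc Ins Q_def
        by (auto simp: FB)
    qed
    with Q show ?thesis by blast
  next
    case (Del x)
    have "y \<notin> P y \<and> card (P y) \<le> n \<and> P y \<subseteq> hop_item ` set (ops @ [a])"
      if "y \<in> present (ops @ [a])" for y
      using that P1[of y] by (auto simp: present_snoc Del)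
    moreover have "fst (fb_run H cap (ops @ [a])) \<subseteq> present (ops @ [a]) \<and>
       snd (fb_run H cap (ops @ [a])) \<subseteq>
         {y \<in> present (ops @ [a]). cap \<le> real (card {z \<in> P y. H z = H y})}" for H
      using F[of H] B[of H] unfolding fb_run_snoc present_snoc Del
      by (cases "fb_run H cap ops") auto
    ultimately show ?thesis by blast
  qed
qed

section \<open>Decoupling the bins\<close>

text \<open>The left side collects the terms of degree at most one in \<open>t\<close> from the
  expanded product; the remaining terms are nonnegative.\<close>

lemma prod_add_linear_part_le:
  fixes u t :: "'b \<Rightarrow> real"
  assumes "finite B" "\<And>b. b \<in> B \<Longrightarrow> 0 \<le> u b" "\<And>b. b \<in> B \<Longrightarrow> 0 \<le> t b"
  shows "(\<Prod>b\<in>B. u b) + (\<Sum>a\<in>B. t a * (\<Prod>b\<in>B - {a}. u b)) \<le> (\<Prod>b\<in>B. u b + t b)"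
  using assms
proof (induction B)
  case (insert x B)
  have e: "(\<Sum>a\<in>B. t a * (\<Prod>b\<in>insert x B - {a}. u b)) = u x * (\<Sum>a\<in>B. t a * (\<Prod>b\<in>B - {a}. u b))"
    unfolding sum_distrib_left
  proof (rule sum.cong)
    fix a assume "a \<in> B"
    then have "insert x B - {a} = insert x (B - {a})" using insert by auto
    then show "t a * (\<Prod>b\<in>insert x B - {a}. u b) = u x * (t a * (\<Prod>b\<in>B - {a}. u b))"
      using insert by simp
  qed simp
  have nn: "0 \<le> (\<Sum>a\<in>B. t a * (\<Prod>b\<in>B - {a}. u b))"
    using insert.prems by (intro sum_nonneg mult_nonneg_nonneg prod_nonneg) auto
  have "(\<Prod>b\<in>insert x B. u b) + (\<Sum>a\<in>insert x B. t a * (\<Prod>b\<in>insert x B - {a}. u b))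
      = u x * ((\<Prod>b\<in>B. u b) + (\<Sum>a\<in>B. t a * (\<Prod>b\<in>B - {a}. u b))) + t x * (\<Prod>b\<in>B. u b)"
    using insert.hyps by (simp add: e algebra_simps)
  also have "\<dots> \<le> (u x + t x) * ((\<Prod>b\<in>B. u b) + (\<Sum>a\<in>B. t a * (\<Prod>b\<in>B - {a}. u b)))"
    using nn insert.prems by (simp add: algebra_simps)
  also have "\<dots> \<le> (u x + t x) * (\<Prod>b\<in>B. u b + t b)"
    using insert by (intro mult_left_mono) auto
  finally show ?case using insert.hyps by simp
qed simp

text \<open>An item chooses exactly one bin on the left, and tosses a separate coin for every bin on
  the right. Writing \<open>v = u + (v - u)\<close>, the left side is the part of the right side of
  degree at most one in the differences, since the weights sum to 1.\<close>

lemma convex_sum_single_swap_le_prod: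
  fixes u v w :: "'b \<Rightarrow> real"
  assumes B: "finite B" and u: "\<And>b. b \<in> B \<Longrightarrow> 0 \<le> u b" and v: "\<And>b. b \<in> B \<Longrightarrow> u b \<le> v b"
    and w: "\<And>b. b \<in> B \<Longrightarrow> 0 \<le> w b" "sum w B = 1"
  shows "(\<Sum>a\<in>B. w a * (\<Prod>b\<in>B. if b = a then v b else u b))
      \<le> (\<Prod>b\<in>B. w b * v b + (1 - w b) * u b)"
proof -
  have "(\<Prod>b\<in>B. if b = a then v b else u b) = v a * (\<Prod>b\<in>B - {a}. u b)" if "a \<in> B" for a
    using B that by (subst prod.remove[of B a]) (auto intro!: prod.cong)
  moreover have "(\<Prod>b\<in>B. u b) = u a * (\<Prod>b\<in>B - {a}. u b)" if "a \<in> B" for a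
    using B that by (subst prod.remove[of B a]) auto
  ultimately have e: "w a * (\<Prod>b\<in>B. if b = a then v b else u b)
      = w a * (\<Prod>b\<in>B. u b) + w a * (v a - u a) * (\<Prod>b\<in>B - {a}. u b)" if "a \<in> B" for a
    using that by (simp add: algebra_simps)
  have "(\<Sum>a\<in>B. w a * (\<Prod>b\<in>B. if b = a then v b else u b))
      = (\<Prod>b\<in>B. u b) + (\<Sum>a\<in>B. w a * (v a - u a) * (\<Prod>b\<in>B - {a}. u b))"
    using w(2) by (simp add: e sum.distrib flip: sum_distrib_right)
  also have "\<dots> \<le> (\<Prod>b\<in>B. u b + w b * (v b - u b))"
    using assms by (intro prod_add_linear_part_le) auto
  finally show ?thesis by (simp add: algebra_simps)
qed

lemma expectation_Pi_pmf_insert: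
  fixes \<phi> :: "('a \<Rightarrow> 'b) \<Rightarrow> real"
  assumes "finite I" "x \<notin> I" "finite B" "set_pmf (p x) \<subseteq> B"
    and "\<And>y. finite (set_pmf (p y))"
  shows "measure_pmf.expectation (Pi_pmf (insert x I) d p) \<phi>
    = measure_pmf.expectation (Pi_pmf I d p) (\<lambda>H. \<Sum>a\<in>B. pmf (p x) a * \<phi> (H(x := a)))"
proof -
  have fin: "finite (set_pmf (Pi_pmf I d p))"
    using assms by (auto simp: set_Pi_pmf intro!: finite_PiE_dflt)
  have "measure_pmf.expectation (Pi_pmf (insert x I) d p) \<phi>
      = (\<Sum>a\<in>B. pmf (p x) a *\<^sub>R measure_pmf.expectation (map_pmf (\<lambda>H. H(x := a)) (Pi_pmf I d p)) \<phi>)"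
    unfolding map_pmf_def using assms fin
    by (subst Pi_pmf_insert', simp, simp, subst pmf_expectation_bind[where A = B])
      (auto intro: finite_imageI)
  also have "\<dots> = measure_pmf.expectation (Pi_pmf I d p) (\<lambda>H. \<Sum>a\<in>B. pmf (p x) a * \<phi> (H(x := a)))"
    by (subst Bochner_Integration.integral_sum) (auto intro!: integrable_measure_pmf_finite fin)
  finally show ?thesis .
qed

text \<open>Negative association of occupancy sets: items are decoupled one at a time.\<close>
lemma expectation_prod_fibres_le:
  fixes q :: "'b pmf" and f :: "'b \<Rightarrow> 'a set \<Rightarrow> real"
  assumes I: "finite I" and B: "finite B" "set_pmf q \<subseteq> B"
    and nonneg: "\<And>b A. 0 \<le> f b A"
    and mono: "\<And>b A A'. A \<subseteq> A' \<Longrightarrow> f b A \<le> f b A'"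
  shows "measure_pmf.expectation (Pi_pmf I d (\<lambda>_. q)) (\<lambda>H. \<Prod>b\<in>B. f b {y \<in> I. H y = b})
      \<le> (\<Prod>b\<in>B. measure_pmf.expectation (Pi_pmf I False (\<lambda>_. bernoulli_pmf (pmf q b)))
            (\<lambda>G. f b {y \<in> I. G y}))"
  using I nonneg mono
proof (induction I arbitrary: f)
  case empty
  then show ?case by simp
next
  case (insert x I)
  let ?M = "Pi_pmf I d (\<lambda>_. q)" and ?N = "\<lambda>b. Pi_pmf I False (\<lambda>_. bernoulli_pmf (pmf q b))"
  \<comment> \<open>\<open>g\<close> averages \<open>f\<close> over the coin of \<open>x\<close>. It
    inherits nonnegativity and monotonicity, so the induction hypothesis applies to it in place of
    \<open>f\<close>.\<close>
  define g where "g b A = pmf q b * f b (insert x A) + (1 - pmf q b) * f b A" for b A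
  have fin: "finite (set_pmf q)" using B finite_subset by blast
  have finM: "finite (set_pmf ?M)" using insert.hyps fin
    by (auto simp: set_Pi_pmf intro!: finite_PiE_dflt)
  have qB: "sum (pmf q) B = 1" using B sum_pmf_eq_1 by blast
  have g0: "0 \<le> g b A" for b A
    using insert.prems(1) by (auto simp: g_def pmf_le_1)
  have gm: "g b A \<le> g b A'" if "A \<subseteq> A'" for b A A'
    unfolding g_def using insert.prems(2)[of A A' b] insert.prems(2)[of "insert x A" "insert x A'" b] that
    by (intro add_mono mult_left_mono) (auto simp: pmf_le_1)
  have fib: "{y \<in> insert x I. (H(x := a)) y = b} = (if b = a then insert x {y \<in> I. H y = b} else {y \<in> I. H y = b})"
    for H :: "'a \<Rightarrow> 'b" and a b using insert.hyps by auto
  have fibG: "{y \<in> insert x I. (G(x := e)) y} = (if e then insert x {y \<in> I. G y} else {y \<in> I. G y})"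
    for G e using insert.hyps by auto
  have "measure_pmf.expectation (Pi_pmf (insert x I) d (\<lambda>_. q)) (\<lambda>H. \<Prod>b\<in>B. f b {y \<in> insert x I. H y = b})
     = measure_pmf.expectation ?M (\<lambda>H. \<Sum>a\<in>B. pmf q a * (\<Prod>b\<in>B. if b = a
          then f b (insert x {y \<in> I. H y = b}) else f b {y \<in> I. H y = b}))"
    using insert.hyps B fin
    by (subst expectation_Pi_pmf_insert[where B = B]) (simp_all only: fib if_distrib[of "f _"] not_False_eq_True)
  \<comment> \<open>With the other items fixed, the single choice of a bin for \<open>x\<close> is
    replaced by one coin per bin.\<close>
  also have "\<dots> \<le> measure_pmf.expectation ?M (\<lambda>H. \<Prod>b\<in>B. g b {y \<in> I. H y = b})"
    unfolding g_def
    by (intro integral_mono integrable_measure_pmf_finite finM convex_sum_single_swap_le_prod)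
      (use B qB insert.prems(1) in \<open>auto intro!: insert.prems(2)\<close>)
  also have "\<dots> \<le> (\<Prod>b\<in>B. measure_pmf.expectation (?N b) (\<lambda>G. g b {y \<in> I. G y}))"
    by (rule insert.IH) (fact g0, erule gm)
  also have "\<dots> = (\<Prod>b\<in>B. measure_pmf.expectation (Pi_pmf (insert x I) False (\<lambda>_. bernoulli_pmf (pmf q b)))
            (\<lambda>G. f b {y \<in> insert x I. G y}))"
    by (rule prod.cong, simp, subst expectation_Pi_pmf_insert[where B = UNIV],
      use insert.hyps in \<open>simp_all only: fibG\<close>) (auto simp: g_def UNIV_bool pmf_le_1 add.commute)
  finally show ?case .
qed

section \<open>Exponential moment of the overflow of one bin\<close>

text \<open>The integrand factorises over the independent items. The factor of \<open>x\<close> has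
  mean at most \<open>p * exp \<mu>\<close> because \<open>x \<notin> P\<close>; every other mean
  has the form \<open>1 + p * (exp (a y) - 1)\<close> and is bounded by an exponential.\<close>

lemma expectation_exp_card_member_le:
  fixes p \<theta> \<mu> :: real
  assumes I: "finite I" "P \<subseteq> I" "S \<subseteq> I" "card P \<le> n" "card S \<le> n"
    and x: "x \<in> I" "x \<notin> P" and p: "0 \<le> p" "p \<le> 1" and nonneg: "0 \<le> \<theta>" "0 \<le> \<mu>"
  shows "measure_pmf.expectation (Pi_pmf I False (\<lambda>_. bernoulli_pmf p))
      (\<lambda>G. of_bool (G x) * exp (\<theta> * card {y \<in> P. G y} + \<mu> * card {y \<in> S. G y}))
    \<le> p * exp \<mu> * exp (p * n * (exp (\<theta> + \<mu>) - 1))"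
proof -
  define a where "a y = \<theta> * of_bool (y \<in> P) + \<mu> * of_bool (y \<in> S)" for y
  \<comment> \<open>The value 0 at \<open>y = x\<close> absorbs the indicator
    \<open>of_bool (G x)\<close> into the product.\<close>
  define \<phi> where "\<phi> y e = (if e then exp (a y) else if y = x then 0 else 1)" for y and e :: bool
  have card_eq: "real (card {y \<in> A. G y}) = (\<Sum>y\<in>I. of_bool (y \<in> A) * of_bool (G y))"
    if "A \<subseteq> I" for A and G
  proof -
    have "{y \<in> A. G y} = {y \<in> I. y \<in> A \<and> G y}" using that by auto
    then show ?thesis using I(1) by (simp add: sum.If_cases Int_def flip: of_bool_conj of_bool_def)
  qed
  have prod: "of_bool (G x) * exp (\<theta> * card {y \<in> P. G y} + \<mu> * card {y \<in> S. G y}) = (\<Prod>y\<in>I. \<phi> y (G y))" for G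
  proof (cases "G x")
    case True
    then have "(\<Prod>y\<in>I. \<phi> y (G y)) = (\<Prod>y\<in>I. exp (a y * of_bool (G y)))"
      by (intro prod.cong) (auto simp: \<phi>_def)
    also have "\<dots> = exp (\<Sum>y\<in>I. a y * of_bool (G y))" using I(1) by (simp only: exp_sum)
    also have "(\<Sum>y\<in>I. a y * of_bool (G y)) = \<theta> * card {y \<in> P. G y} + \<mu> * card {y \<in> S. G y}"
      by (simp only: card_eq[OF I(2)] card_eq[OF I(3)] a_def sum.distrib sum_distrib_left distrib_right mult.assoc)
    finally show ?thesis using True by simp
  next
    case False
    then have "(\<Prod>y\<in>I. \<phi> y (G y)) = 0" using I(1) x by (intro prod_zero) (auto simp: \<phi>_def)
    then show ?thesis using False by simp
  qed
  \<comment> \<open>Splitting \<open>exp (\<theta> + \<mu>) - 1\<close> as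
    \<open>(exp \<theta> - 1) * exp \<mu> + (exp \<mu> - 1)\<close> charges \<open>P\<close> and
    \<open>S\<close> separately, so the bound uses their sizes whatever their overlap.\<close>
  have step: "exp (a y) - 1 \<le> of_bool (y \<in> P) * ((exp \<theta> - 1) * exp \<mu>) + of_bool (y \<in> S) * (exp \<mu> - 1)" for y
  proof -
    have "(exp \<theta> - 1) * 1 \<le> (exp \<theta> - 1) * exp \<mu>"
      using nonneg by (intro mult_left_mono) auto
    then show ?thesis
      by (cases "y \<in> P"; cases "y \<in> S") (simp_all add: a_def exp_add algebra_simps)
  qed
  have cards: "(\<Sum>y\<in>I. of_bool (y \<in> A) :: real) \<le> n" if "A \<subseteq> I" "card A \<le> n" for A
    using card_eq[of A "\<lambda>_. True"] that by simp
  have a0: "0 \<le> a y" for y using nonneg by (simp add: a_def)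
  have "(\<Sum>y\<in>I - {x}. exp (a y) - 1) \<le> (\<Sum>y\<in>I. exp (a y) - 1)"
    using I(1) a0 by (intro sum_mono2) auto
  also have "\<dots> \<le> (\<Sum>y\<in>I. of_bool (y \<in> P) * ((exp \<theta> - 1) * exp \<mu>) + of_bool (y \<in> S) * (exp \<mu> - 1))"
    by (intro sum_mono step)
  also have "\<dots> = (\<Sum>y\<in>I. of_bool (y \<in> P)) * ((exp \<theta> - 1) * exp \<mu>) + (\<Sum>y\<in>I. of_bool (y \<in> S)) * (exp \<mu> - 1)"
    by (simp only: sum.distrib sum_distrib_right)
  also have "\<dots> \<le> real n * ((exp \<theta> - 1) * exp \<mu>) + real n * (exp \<mu> - 1)"
    using I nonneg by (intro add_mono mult_right_mono cards) auto
  finally have total: "(\<Sum>y\<in>I - {x}. exp (a y) - 1) \<le> n * (exp (\<theta> + \<mu>) - 1)"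
    by (simp add: exp_add algebra_simps)
  have "measure_pmf.expectation (Pi_pmf I False (\<lambda>_. bernoulli_pmf p))
      (\<lambda>G. of_bool (G x) * exp (\<theta> * card {y \<in> P. G y} + \<mu> * card {y \<in> S. G y}))
      = (\<Prod>y\<in>I. measure_pmf.expectation (bernoulli_pmf p) (\<phi> y))"
    unfolding prod using I(1)
    by (intro expectation_prod_Pi_pmf integrable_measure_pmf_finite) (auto simp: \<phi>_def)
  also have "\<dots> = (\<Prod>y\<in>I. exp (a y) * p + (if y = x then 0 else 1 - p))"
    using p by (intro prod.cong) (auto simp: \<phi>_def)
  also have "\<dots> = exp (a x) * p * (\<Prod>y\<in>I - {x}. exp (a y) * p + (1 - p))"
    using I(1) x by (simp add: prod.remove)
  also have "\<dots> \<le> exp \<mu> * p * (\<Prod>y\<in>I - {x}. exp (p * (exp (a y) - 1)))"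
  proof (intro mult_mono prod_mono conjI)
    show "exp (a x) \<le> exp \<mu>" using x nonneg by (simp add: a_def)
    fix y
    show "exp (a y) * p + (1 - p) \<le> exp (p * (exp (a y) - 1))"
      using exp_ge_add_one_self[of "p * (exp (a y) - 1)"] by (simp add: algebra_simps)
    show "0 \<le> exp (a y) * p + (1 - p)" using p by simp
  qed (use p in \<open>auto intro!: prod_nonneg\<close>)
  also have "(\<Prod>y\<in>I - {x}. exp (p * (exp (a y) - 1))) = exp (p * (\<Sum>y\<in>I - {x}. exp (a y) - 1))"
    using I(1) by (simp add: exp_sum sum_distrib_left)
  also have "exp \<mu> * p * \<dots> \<le> exp \<mu> * p * exp (p * (n * (exp (\<theta> + \<mu>) - 1)))"
    using total p by (intro mult_left_mono) (auto intro!: mult_left_mono)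
  finally show ?thesis by (simp add: mult_ac)
qed

text \<open>The excess capacity gains \<open>\<theta> * j * sqrt h = j\<^sup>2 / 2\<close>, and the
  second-order term costs \<open>h * \<theta>\<^sup>2 = j\<^sup>2 / 4\<close>; this
  \<open>\<theta>\<close> maximises the difference. The constant 2 covers all terms that
  remain.\<close>

lemma overflow_exponent_le:
  fixes h j cap :: real
  assumes h: "1 \<le> h" and j: "0 < j" "j \<le> sqrt h" and cap: "h + j * sqrt h \<le> cap"
  defines "\<theta> \<equiv> j / (2 * sqrt h)" and "\<mu> \<equiv> 1 / (2 * h)"
  shows "\<mu> + h * (exp (\<theta> + \<mu>) - 1) - \<theta> * cap \<le> 2 - j\<^sup>2 / 4"
proof -
  define s where "s = sqrt h"
  have s: "1 \<le> s" "h = s\<^sup>2" using h by (auto simp: s_def)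
  have js: "0 < j" "j \<le> s" using j by (auto simp: s_def)
  have \<theta>: "\<theta> = j / (2 * s)" and \<mu>: "\<mu> = 1 / (2 * s\<^sup>2)" by (simp add: \<theta>_def s_def, simp add: \<mu>_def s(2))
  have \<theta>1: "0 \<le> \<theta>" "\<theta> \<le> 1 / 2" using s js by (auto simp: \<theta> field_simps)
  have \<mu>1: "0 \<le> \<mu>" "\<mu> \<le> 1 / 2" using s by (auto simp: \<mu> field_simps)
  \<comment> \<open>The quadratic bound requires \<open>\<theta> + \<mu> \<le> 1\<close>, which
    follows from \<open>j \<le> sqrt h\<close> and \<open>1 \<le> h\<close>.\<close>
  have "exp (\<theta> + \<mu>) - 1 \<le> (\<theta> + \<mu>) + (\<theta> + \<mu>)\<^sup>2"
    using exp_bound[of "\<theta> + \<mu>"] \<theta>1 \<mu>1 by simp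
  then have "h * (exp (\<theta> + \<mu>) - 1) \<le> h * ((\<theta> + \<mu>) + (\<theta> + \<mu>)\<^sup>2)"
    using h by (intro mult_left_mono) auto
  also have "\<dots> = \<theta> * h + 1 / 2 + j\<^sup>2 / 4 + \<theta> + \<mu> / 2"
    using s by (simp add: \<theta> \<mu> field_simps power2_eq_square)
  finally have 1: "h * (exp (\<theta> + \<mu>) - 1) \<le> \<theta> * h + 1 / 2 + j\<^sup>2 / 4 + \<theta> + \<mu> / 2" .
  have "\<theta> * (h + j * s) \<le> \<theta> * cap"
    using cap \<theta>1 by (intro mult_left_mono) (auto simp: s_def)
  moreover have "\<theta> * (h + j * s) = \<theta> * h + j\<^sup>2 / 2"
    using s by (simp add: \<theta> field_simps power2_eq_square)
  ultimately show ?thesis using 1 \<theta>1 \<mu>1 by linarith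
qed

lemma expectation_exp_overflow_le:
  fixes h j cap :: real
  assumes I: "finite I" "S \<subseteq> I" "card S \<le> n"
    and P: "\<And>x. x \<in> S \<Longrightarrow> P x \<subseteq> I \<and> x \<notin> P x \<and> card (P x) \<le> n"
    and h: "1 \<le> h" "h \<le> n" and j: "0 < j" "j \<le> sqrt h" and cap: "h + j * sqrt h \<le> cap"
  shows "measure_pmf.expectation (Pi_pmf I False (\<lambda>_. bernoulli_pmf (h / n)))
      (\<lambda>G. exp (1 / (2 * h) * card {x \<in> S. G x \<and> cap \<le> card {y \<in> P x. G y}}))
    \<le> exp (exp (2 - j\<^sup>2 / 4) / 2)"
proof -
  define \<theta> \<mu> p where "\<theta> = j / (2 * sqrt h)" and "\<mu> = 1 / (2 * h)" and "p = h / n"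
  let ?M = "Pi_pmf I False (\<lambda>_. bernoulli_pmf p)"
  define Z where "Z x G = of_bool (G x) * exp (\<theta> * card {y \<in> P x. G y} + \<mu> * card {y \<in> S. G y})" for x G
  have finS: "finite S" using I finite_subset by blast
  have nn: "0 < \<theta>" "0 < \<mu>" "0 \<le> p" "p \<le> 1" using h j by (auto simp: \<theta>_def \<mu>_def p_def)
  have pn: "p * n = h" using h by (simp add: p_def)
  have intg: "integrable (measure_pmf ?M) g" for g :: "_ \<Rightarrow> real"
    using I by (intro integrable_measure_pmf_finite) (auto simp: set_Pi_pmf intro!: finite_PiE_dflt)
  have pw: "exp (\<mu> * card {x \<in> S. G x \<and> cap \<le> card {y \<in> P x. G y}})
      \<le> 1 + \<mu> * exp (- (\<theta> * cap)) * (\<Sum>x\<in>S. Z x G)" for G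
  proof -
    let ?Y = "card {x \<in> S. G x \<and> cap \<le> card {y \<in> P x. G y}}" and ?s = "card {y \<in> S. G y}"
    \<comment> \<open>From \<open>1 - t \<le> exp (- t)\<close> follows
      \<open>exp t \<le> 1 + t * exp t\<close>; the factor \<open>t\<close> becomes a sum over the
      items of \<open>S\<close>.\<close>
    have "1 - \<mu> * ?Y \<le> exp (- (\<mu> * ?Y))"
      using exp_ge_add_one_self[of "- (\<mu> * ?Y)"] by simp
    then have "exp (\<mu> * ?Y) * (1 - \<mu> * ?Y) \<le> exp (\<mu> * ?Y) * exp (- (\<mu> * ?Y))"
      by (intro mult_left_mono) auto
    then have "exp (\<mu> * ?Y) \<le> 1 + \<mu> * ?Y * exp (\<mu> * ?Y)"
      by (simp add: exp_minus_inverse algebra_simps)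
    also have "\<dots> \<le> 1 + \<mu> * (?Y * exp (\<mu> * ?s))"
    proof -
      have "?Y \<le> ?s" using finS by (intro card_mono) auto
      then show ?thesis using nn by (simp add: mult.assoc mult_left_mono)
    qed
    also have "real ?Y * exp (\<mu> * ?s) = (\<Sum>x\<in>S. of_bool (G x \<and> cap \<le> card {y \<in> P x. G y}) * exp (\<mu> * ?s))"
      using finS by (simp add: Int_def flip: sum_distrib_right)
    \<comment> \<open>The indicator that a count reaches \<open>cap\<close> is at most the
      exponential of \<open>\<theta>\<close> times the count minus \<open>cap\<close>.\<close>
    also have "\<dots> \<le> (\<Sum>x\<in>S. exp (- (\<theta> * cap)) * Z x G)"
    proof (intro sum_mono)
      fix x
      show "of_bool (G x \<and> cap \<le> card {y \<in> P x. G y}) * exp (\<mu> * ?s) \<le> exp (- (\<theta> * cap)) * Z x G"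
        using nn by (auto simp: Z_def simp flip: exp_add)
    qed
    finally show ?thesis using nn by (simp add: sum_distrib_left mult.assoc mult_left_mono)
  qed
  have "measure_pmf.expectation ?M (\<lambda>G. exp (\<mu> * card {x \<in> S. G x \<and> cap \<le> card {y \<in> P x. G y}}))
      \<le> measure_pmf.expectation ?M (\<lambda>G. 1 + \<mu> * exp (- (\<theta> * cap)) * (\<Sum>x\<in>S. Z x G))"
    by (intro integral_mono intg pw)
  also have "\<dots> = 1 + \<mu> * exp (- (\<theta> * cap)) * (\<Sum>x\<in>S. measure_pmf.expectation ?M (Z x))"
    using intg by (simp add: Bochner_Integration.integral_add Bochner_Integration.integral_sum)
  also have "\<dots> \<le> 1 + \<mu> * exp (- (\<theta> * cap)) * (\<Sum>x\<in>S. p * exp \<mu> * exp (p * n * (exp (\<theta> + \<mu>) - 1)))"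
    unfolding Z_def using I P nn
    by (intro add_left_mono mult_left_mono sum_mono expectation_exp_card_member_le) auto
  also have "\<dots> = 1 + \<mu> * (card S * p) * exp (\<mu> + h * (exp (\<theta> + \<mu>) - 1) - \<theta> * cap)"
    by (simp add: pn exp_add exp_diff exp_minus field_simps)
  also have "\<dots> \<le> 1 + \<mu> * (n * p) * exp (2 - j\<^sup>2 / 4)"
    using overflow_exponent_le[OF h(1) j cap] nn I(3) unfolding \<theta>_def[symmetric] \<mu>_def[symmetric]
    by (intro add_left_mono mult_mono mult_left_mono mult_right_mono) auto
  \<comment> \<open>Here \<open>\<mu> * (n * p) = \<mu> * h = 1 / 2\<close>.\<close>
  also have "\<dots> = 1 + exp (2 - j\<^sup>2 / 4) / 2"
    using h pn by (simp add: \<mu>_def mult.commute)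
  also have "\<dots> \<le> exp (exp (2 - j\<^sup>2 / 4) / 2)" by (rule exp_ge_add_one_self)
  finally show ?thesis by (simp add: \<mu>_def p_def)
qed

section \<open>Tail bound for the total overflow at one time\<close>

text \<open>The moment bounds of the bins multiply to the exponential of \<open>\<mu>\<close> times
  the first term of the threshold, so Markov's inequality leaves \<open>\<mu> * exp 2 * D\<close> in
  the exponent.\<close>

lemma prob_overflow_le:
  fixes h j cap D :: real and m n :: nat and P :: "'a \<Rightarrow> 'a set"
  assumes I: "finite I" "S \<subseteq> I" "card S \<le> n"
    and P: "\<And>x. x \<in> S \<Longrightarrow> P x \<subseteq> I \<and> x \<notin> P x \<and> card (P x) \<le> n"
    and h: "1 \<le> h" "real n = m * h" "0 < m" and j: "0 < j" "j \<le> sqrt h"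
    and cap: "h + j * sqrt h \<le> cap"
  shows "measure_pmf.prob (Pi_pmf I d (\<lambda>_. pmf_of_set {..<m}))
      {H. exp 2 * (n * exp (- (j\<^sup>2 / 4)) + D) < card {x \<in> S. cap \<le> card {y \<in> P x. H y = H x}}}
    \<le> exp (- (exp 2 * D / (2 * h)))"
proof -
  let ?q = "pmf_of_set {..<m}"
  let ?M = "Pi_pmf I d (\<lambda>_. ?q)"
  define \<mu> where "\<mu> = 1 / (2 * h)"
  \<comment> \<open>The overflow of a bin is expressed through the set \<open>A\<close> of all items
    of \<open>I\<close> hashed to it, the form that the decoupling requires.\<close>
  define Y where "Y A = card {x \<in> S. x \<in> A \<and> cap \<le> card (P x \<inter> A)}" for A
  define X where "X H = card {x \<in> S. cap \<le> card {y \<in> P x. H y = H x}}" for H :: "'a \<Rightarrow> nat"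
  define T where "T = exp 2 * (n * exp (- (j\<^sup>2 / 4)) + D)"
  have \<mu>: "0 < \<mu>" using h by (simp add: \<mu>_def)
  have m: "{..<m} \<noteq> {}" "finite {..<m}" using h by auto
  have finS: "finite S" using I finite_subset by blast
  have finP: "finite (P x)" if "x \<in> S" for x using P[OF that] I finite_subset by blast
  have finM: "finite (set_pmf ?M)"
    using I m by (auto simp: set_Pi_pmf intro!: finite_PiE_dflt)
  \<comment> \<open>Restricting \<open>H\<close> to the support ensures that every item of
    \<open>S\<close> lies in one of the bins below \<open>m\<close>.\<close>
  have X_eq: "X H = (\<Sum>b<m. Y {y \<in> I. H y = b})" if H: "H \<in> set_pmf ?M" for H
  proof -
    have H': "H x < m" if "x \<in> S" for x
      using H that I m by (auto simp: set_Pi_pmf PiE_dflt_def)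
    have *: "P x \<inter> {y \<in> I. H y = H x} = {y \<in> P x. H y = H x}" if "x \<in> S" for x
      using P[OF that] by auto
    have "{x \<in> S. cap \<le> card {y \<in> P x. H y = H x}}
        = (\<Union>b<m. {x \<in> S. x \<in> {y \<in> I. H y = b} \<and> cap \<le> card (P x \<inter> {y \<in> I. H y = b})})"
      using I H' by (auto simp: *)
    then show ?thesis unfolding X_def Y_def
      using finS by (subst card_UN_disjoint[symmetric]) auto
  qed
  have Ymono: "Y A \<le> Y A'" if "A \<subseteq> A'" for A A'
    unfolding Y_def
  proof (rule card_mono)
    have "card (P x \<inter> A) \<le> card (P x \<inter> A')" if "x \<in> S" for x
      using finP[OF that] \<open>A \<subseteq> A'\<close> by (intro card_mono) auto
    then show "{x \<in> S. x \<in> A \<and> cap \<le> card (P x \<inter> A)} \<subseteq> {x \<in> S. x \<in> A' \<and> cap \<le> card (P x \<inter> A')}"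
      using \<open>A \<subseteq> A'\<close> by (fastforce intro: order_trans)
  qed (use finS in auto)
  have "measure_pmf.expectation ?M (\<lambda>H. exp (\<mu> * X H))
      = measure_pmf.expectation ?M (\<lambda>H. \<Prod>b<m. exp (\<mu> * Y {y \<in> I. H y = b}))"
    by (intro integral_cong_AE AE_pmfI) (auto simp: X_eq exp_sum sum_distrib_left)
  also have "\<dots> \<le> (\<Prod>b<m. measure_pmf.expectation (Pi_pmf I False (\<lambda>_. bernoulli_pmf (pmf ?q b)))
      (\<lambda>G. exp (\<mu> * Y {y \<in> I. G y})))"
    using I m \<mu> by (intro expectation_prod_fibres_le) (auto intro!: Ymono)
  also have "\<dots> \<le> (\<Prod>b<m. exp (exp (2 - j\<^sup>2 / 4) / 2))"
  proof (intro prod_mono conjI)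
    fix b assume b: "b \<in> {..<m}"
    have "Y {y \<in> I. G y} = card {x \<in> S. G x \<and> cap \<le> card {y \<in> P x. G y}}" for G
    proof -
      have "P x \<inter> {y \<in> I. G y} = {y \<in> P x. G y}" if "x \<in> S" for x using P[OF that] by auto
      then show ?thesis unfolding Y_def using I by (intro arg_cong[where f = card]) auto
    qed
    moreover have "pmf ?q b = h / n" using b m h by simp
    moreover have "h \<le> n" using h by simp
    ultimately show "measure_pmf.expectation (Pi_pmf I False (\<lambda>_. bernoulli_pmf (pmf ?q b)))
        (\<lambda>G. exp (\<mu> * Y {y \<in> I. G y})) \<le> exp (exp (2 - j\<^sup>2 / 4) / 2)"
      unfolding \<mu>_def using expectation_exp_overflow_le[OF I P h(1) _ j cap] by simp
  qed (auto intro!: integral_nonneg)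
  \<comment> \<open>The \<open>m\<close> factors contribute \<open>m / 2\<close>, which equals
    \<open>\<mu> * n\<close> because \<open>n = m * h\<close>.\<close>
  also have "\<dots> = exp (\<mu> * (exp 2 * (n * exp (- (j\<^sup>2 / 4)))))"
  proof -
    have "exp (2 - j\<^sup>2 / 4) = exp 2 * exp (- (j\<^sup>2 / 4))" by (simp flip: exp_add)
    then show ?thesis using h by (simp add: \<mu>_def flip: exp_of_nat_mult)
  qed
  finally have E: "measure_pmf.expectation ?M (\<lambda>H. exp (\<mu> * X H)) \<le> \<dots>" .
  have "measure_pmf.prob ?M {H. T < X H} \<le> measure_pmf.prob ?M {H \<in> space ?M. exp (\<mu> * T) \<le> exp (\<mu> * X H)}"
    using \<mu> by (intro measure_pmf.finite_measure_mono) auto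
  also have "\<dots> \<le> measure_pmf.expectation ?M (\<lambda>H. exp (\<mu> * X H)) / exp (\<mu> * T)"
    by (rule integral_Markov_inequality_measure[where A = "{}"])
      (auto intro: integrable_measure_pmf_finite finM)
  also have "\<dots> \<le> exp (\<mu> * (exp 2 * (n * exp (- (j\<^sup>2 / 4))))) / exp (\<mu> * T)"
    using E by (intro divide_right_mono) auto
  also have "\<dots> = exp (- (exp 2 * D / (2 * h)))"
    by (simp add: T_def \<mu>_def algebra_simps add_divide_distrib flip: exp_diff)
  finally show ?thesis by (simp add: T_def X_def)
qed

section \<open>From overflow to the backyard at all times\<close>

text \<open>The order of choice matters: \<open>P\<close> is fixed before \<open>H\<close>, so these
  sets are deterministic when \<open>H\<close> is drawn at random.\<close>

lemma backyard_size_le_overflow: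
  assumes "valid_seq n ops"
  obtains P where "\<And>x. x \<in> present ops \<Longrightarrow> P x \<subseteq> hop_item ` set ops \<and> x \<notin> P x \<and> card (P x) \<le> n"
    and "\<And>H. backyard_size H cap ops \<le> card {x \<in> present ops. cap \<le> real (card {y \<in> P x. H y = H x})}"
proof -
  obtain P where P: "\<forall>x\<in>present ops. x \<notin> P x \<and> card (P x) \<le> n \<and> P x \<subseteq> hop_item ` set ops"
    "\<And>H. snd (fb_run H cap ops) \<subseteq> {x \<in> present ops. cap \<le> real (card {y \<in> P x. H y = H x})}"
    using backyard_witness_sets[OF assms, of cap] by blast
  show ?thesis
    using P finite_present[of ops] by (intro that[of P]) (auto simp: backyard_size_def intro!: card_mono)
qed

lemma backyard_size_le:
  assumes "valid_seq n ops"
  shows "backyard_size H cap ops \<le> n"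
proof -
  obtain P where "backyard_size H cap ops \<le> card {x \<in> present ops. cap \<le> real (card {y \<in> P x. H y = H x})}"
    by (rule backyard_size_le_overflow[OF assms, of cap]) blast
  also have "\<dots> \<le> card (present ops)"
    using finite_present by (intro card_mono) auto
  also have "\<dots> \<le> n" using assms by (rule card_present_le)
  finally show ?thesis .
qed

lemma prob_backyard_gt_le:
  fixes h j D :: real and m n :: nat
  assumes ops: "valid_seq n ops"
    and h: "1 \<le> h" "real n = m * h" "0 < m" and j: "0 < j" "j \<le> sqrt h"
  shows "measure_pmf.prob (hash_pmf m ops)
      {H. exp 2 * (n / 2 powr (1 / 4 * j\<^sup>2) + D)
        < backyard_size H (h + j * sqrt (h + 1) + 1) (take k ops)}
    \<le> exp (- (exp 2 * D / (2 * h)))" (is "measure_pmf.prob _ ?E \<le> _")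
proof -
  let ?cap = "h + j * sqrt (h + 1) + 1" and ?S = "present (take k ops)"
  have v: "valid_seq n (take k ops)" using ops by (rule valid_seq_take)
  \<comment> \<open>\<open>hash_pmf\<close> is indexed by the items of the whole sequence, so the
    sets of a prefix are placed inside that index set.\<close>
  have sub: "hop_item ` set (take k ops) \<subseteq> hop_item ` set ops"
    by (intro image_mono set_take_subset)
  obtain P where P: "\<And>x. x \<in> ?S \<Longrightarrow> P x \<subseteq> hop_item ` set (take k ops) \<and> x \<notin> P x \<and> card (P x) \<le> n"
    and le: "\<And>H. backyard_size H ?cap (take k ops)
      \<le> card {x \<in> ?S. ?cap \<le> real (card {y \<in> P x. H y = H x})}"
    by (rule backyard_size_le_overflow[OF v, of ?cap]) blast
  have "j * sqrt h \<le> j * sqrt (h + 1)" using j by (intro mult_left_mono) auto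
  then have cap: "h + j * sqrt h \<le> ?cap" by simp
  \<comment> \<open>Since \<open>ln 2 \<le> 1\<close>, passing from base e to base 2 only raises the
    threshold and keeps the constant \<open>1 / 4\<close>.\<close>
  have "2 powr (1 / 4 * j\<^sup>2) \<le> exp (j\<^sup>2 / 4)"
    using ln_le_minus_one[of "2::real"] by (simp add: powr_def mult_left_le)
  then have "n / exp (j\<^sup>2 / 4) \<le> n / 2 powr (1 / 4 * j\<^sup>2)"
    by (intro divide_left_mono) auto
  then have "exp 2 * (n * exp (- (j\<^sup>2 / 4)) + D) \<le> exp 2 * (n / 2 powr (1 / 4 * j\<^sup>2) + D)"
    unfolding exp_minus divide_inverse[symmetric] by (intro mult_left_mono add_right_mono) auto
  note less = order_less_le_trans[OF order_le_less_trans[OF this] of_nat_mono[OF le]]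
  have "?E \<subseteq> {H. exp 2 * (n * exp (- (j\<^sup>2 / 4)) + D)
      < card {x \<in> ?S. ?cap \<le> card {y \<in> P x. H y = H x}}}"
    by (intro Collect_mono impI) (rule less)
  then have "measure_pmf.prob (hash_pmf m ops) ?E \<le> measure_pmf.prob (hash_pmf m ops)
      {H. exp 2 * (n * exp (- (j\<^sup>2 / 4)) + D) < card {x \<in> ?S. ?cap \<le> card {y \<in> P x. H y = H x}}}"
    by (intro measure_pmf.finite_measure_mono) auto
  also have "\<dots> \<le> exp (- (exp 2 * D / (2 * h)))"
    unfolding hash_pmf_def using P sub present_subset_items[of "take k ops"] card_present_le[OF v]
    by (intro prob_overflow_le h j cap) blast+
  finally show ?thesis .
qed

text \<open>At the largest admissible \<open>h\<close>, the deviation divided by \<open>h\<close>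
  equals \<open>sqrt n * ln n\<close>; by \<open>a\<^sup>2 \<le> n\<close> this is at least
  \<open>a * ln n\<close>.\<close>

lemma exp_neg_deviation_le:
  fixes h :: real and n a :: nat
  assumes n: "2 \<le> n" "a\<^sup>2 \<le> n" and h: "0 < h" "h \<le> real n powr (1/4) / sqrt (ln n)"
  shows "exp (- (exp 2 * (real n powr (3/4) * sqrt (ln n)) / (2 * h))) \<le> 1 / real n ^ a"
proof -
  define L where "L = ln (real n)"
  have L: "0 < L" using n by (simp add: L_def)
  have "h * (a * L) \<le> real n powr (1/4) / sqrt L * (real n powr (1/2) * L)"
  proof (intro mult_mono)
    have "real a = sqrt (real (a\<^sup>2))" by simp
    also have "\<dots> \<le> sqrt n" using n by (intro real_sqrt_le_mono) linarith
    finally show "real a \<le> real n powr (1/2)" using n by (simp add: powr_half_sqrt)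
  qed (use h L in \<open>auto simp: L_def\<close>)
  also have "\<dots> = (real n powr (1/4) * real n powr (1/2)) * (L / sqrt L)" by simp
  also have "\<dots> = real n powr (3/4) * sqrt L"
    using L by (simp add: real_div_sqrt flip: powr_add)
  finally have D: "h * (a * L) \<le> real n powr (3/4) * sqrt L" .
  have "a * L \<le> real n powr (3/4) * sqrt L / h"
    using D h by (simp add: field_simps)
  also have "\<dots> \<le> (exp 2 / 2) * (real n powr (3/4) * sqrt L / h)"
  proof -
    have "1 \<le> exp (2::real) / 2" using exp_ge_add_one_self[of "2::real"] by simp
    moreover have "0 \<le> real n powr (3/4) * sqrt L / h" using h L by simp
    ultimately have "1 * (real n powr (3/4) * sqrt L / h) \<le> (exp 2 / 2) * (real n powr (3/4) * sqrt L / h)"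
      by (rule mult_right_mono)
    then show ?thesis by (simp only: mult_1)
  qed
  finally have "exp (- (exp 2 * (real n powr (3/4) * sqrt L) / (2 * h))) \<le> exp (- (a * L))"
    by simp
  also have "\<dots> = 1 / real n ^ a"
    using n by (simp add: L_def exp_minus exp_of_nat_mult inverse_eq_divide)
  finally show ?thesis by (simp add: L_def)
qed

text \<open>For \<open>h \<ge> 1\<close> each time fails with probability at most
  \<open>1 / n ^ (c + d + 1)\<close>, and there are at most \<open>n ^ (c + 1)\<close> times. The
  lower bound on \<open>n\<close> supplies \<open>a\<^sup>2 \<le> n\<close> for
  \<open>a = c + d + 1\<close>, and also \<open>2 \<le> n\<close>.\<close>

lemma prob_max_backyard_gt_le:
  fixes n m c d :: nat and h j :: real
  assumes n: "(c + d + 1)\<^sup>2 + 2 \<le> n" and h: "0 < h" "h \<le> real n powr (1/4) / sqrt (ln (real n))"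
    and j: "0 < j" "j \<le> sqrt h" and m: "real m = real n / h"
    and ops: "length ops \<le> m ^ c" "valid_seq n ops"
  shows "measure_pmf.prob (hash_pmf m ops)
         {H. \<exists>k \<le> length ops.
               real (backyard_size H (h + j * sqrt (h + 1) + 1) (take k ops))
               > exp 2 * (real n / 2 powr (1 / 4 * j\<^sup>2) + real n powr (3/4) * sqrt (ln (real n)))}
       \<le> 1 / real n ^ d"
proof (cases "h < 1")
  case True
  \<comment> \<open>As \<open>j\<^sup>2 \<le> h < 1\<close>, the threshold is at least
    \<open>3 * n / 2\<close>, while the backyard holds at most \<open>n\<close> items: the event is
    empty.\<close>
  have "j\<^sup>2 \<le> h" using j h by (metis less_eq_real_def power_mono real_sqrt_pow2)
  then have "2 powr (1 / 4 * j\<^sup>2) \<le> (2::real) powr 1" using True by (intro powr_mono) auto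
  then have "real n / 2 \<le> real n / 2 powr (1 / 4 * j\<^sup>2)" by (intro divide_left_mono) auto
  moreover have "3 \<le> exp (2::real)" using exp_ge_add_one_self[of "2::real"] by simp
  moreover have "0 \<le> real n powr (3/4) * sqrt (ln (real n))" using n by simp
  ultimately have "3 * (real n / 2) \<le> exp 2 * (real n / 2 powr (1 / 4 * j\<^sup>2) + real n powr (3/4) * sqrt (ln (real n)))"
    by (intro mult_mono) auto
  moreover have "real (backyard_size H (h + j * sqrt (h + 1) + 1) (take k ops)) \<le> n" for H k
    using backyard_size_le[OF valid_seq_take[OF ops(2)]] by simp
  ultimately have "\<not> real (backyard_size H (h + j * sqrt (h + 1) + 1) (take k ops))
      > exp 2 * (real n / 2 powr (1 / 4 * j\<^sup>2) + real n powr (3/4) * sqrt (ln (real n)))" for H k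
    by (smt (verit) field_sum_of_halves of_nat_0_le_iff)
  then show ?thesis by simp
next
  case False
  define D where "D = real n powr (3/4) * sqrt (ln (real n))"
  let ?E = "\<lambda>k. {H. exp 2 * (n / 2 powr (1 / 4 * j\<^sup>2) + D)
        < backyard_size H (h + j * sqrt (h + 1) + 1) (take k ops)}"
  have n2: "2 \<le> n" using n by simp
  have nm: "real n = m * h" using m h by simp
  have m0: "0 < m" using nm n2 by (cases m) auto
  have "m \<le> n"
  proof -
    have "real m * 1 \<le> m * h" using False by (intro mult_left_mono) auto
    then show ?thesis using nm by simp
  qed
  then have "length ops \<le> n ^ c" using ops(1) power_mono[of m n c] by linarith
  moreover have "1 \<le> n ^ c" using n2 by simp
  \<comment> \<open>Prefixes of length 0 up to \<open>length ops\<close> give one more time than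
    there are operations; the extra factor \<open>n \<ge> 2\<close> absorbs it.\<close>
  moreover have "2 * n ^ c \<le> n ^ (c + 1)" using n2 by simp
  ultimately have len: "length ops + 1 \<le> n ^ (c + 1)" by linarith
  have "measure_pmf.prob (hash_pmf m ops) (\<Union>k\<in>{..length ops}. ?E k)
      \<le> (\<Sum>k\<in>{..length ops}. measure_pmf.prob (hash_pmf m ops) (?E k))"
    by (intro measure_pmf.finite_measure_subadditive_finite) auto
  also have "\<dots> \<le> (\<Sum>k\<in>{..length ops}. 1 / real n ^ (c + d + 1))"
  proof (intro sum_mono)
    fix k
    have "measure_pmf.prob (hash_pmf m ops) (?E k) \<le> exp (- (exp 2 * D / (2 * h)))"
      using False nm m0 j ops(2) by (intro prob_backyard_gt_le) auto
    also have "\<dots> \<le> 1 / real n ^ (c + d + 1)"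
      unfolding D_def using n n2 h by (intro exp_neg_deviation_le) auto
    finally show "measure_pmf.prob (hash_pmf m ops) (?E k) \<le> 1 / real n ^ (c + d + 1)" .
  qed
  also have "\<dots> = real (length ops + 1) / real n ^ (c + d + 1)" by simp
  also have "\<dots> \<le> real (n ^ (c + 1)) / real n ^ (c + d + 1)"
    using len by (intro divide_right_mono) (simp_all only: of_nat_le_iff zero_le_power of_nat_0_le_iff)
  also have "\<dots> = 1 / real n ^ d" using n2 by (simp add: power_add)
  finally show ?thesis by (simp add: D_def UNION_eq Bex_def)
qed

theorem theorem2p1:
  shows "\<forall>c d :: nat. \<exists>C \<kappa> :: real. \<exists>N0 :: nat. C > 0 \<and> \<kappa> > 0 \<and>
    (\<forall>(n::nat) (m::nat) (h::real) (j::real) (ops::hop list).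
       n \<ge> max 1 N0 \<and> h > 0 \<and> j > 0 \<and>
       h \<le> real n powr (1/4) / sqrt (ln (real n)) \<and> j \<le> sqrt h \<and>
       real m = real n / h \<and>
       length ops \<le> m ^ c \<and> valid_seq n ops \<longrightarrow>
       measure_pmf.prob (hash_pmf m ops)
         {H. \<exists>k \<le> length ops.
               real (backyard_size H (h + j * sqrt (h + 1) + 1) (take k ops))
               > C * (real n / 2 powr (\<kappa> * j\<^sup>2) + real n powr (3/4) * sqrt (ln (real n)))}
       \<le> 1 / real n ^ d)"
proof (intro allI)
  fix c d :: nat
  show "\<exists>C \<kappa> :: real. \<exists>N0 :: nat. C > 0 \<and> \<kappa> > 0 \<and>
    (\<forall>(n::nat) (m::nat) (h::real) (j::real) (ops::hop list).
       n \<ge> max 1 N0 \<and> h > 0 \<and> j > 0 \<and>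
       h \<le> real n powr (1/4) / sqrt (ln (real n)) \<and> j \<le> sqrt h \<and>
       real m = real n / h \<and>
       length ops \<le> m ^ c \<and> valid_seq n ops \<longrightarrow>
       measure_pmf.prob (hash_pmf m ops)
         {H. \<exists>k \<le> length ops.
               real (backyard_size H (h + j * sqrt (h + 1) + 1) (take k ops))
               > C * (real n / 2 powr (\<kappa> * j\<^sup>2) + real n powr (3/4) * sqrt (ln (real n)))}
       \<le> 1 / real n ^ d)"
    \<comment> \<open>The constants \<open>exp 2\<close> and \<open>1 / 4\<close> come from the
      exponent \<open>2 - j\<^sup>2 / 4\<close> in \<open>overflow_exponent_le\<close>.\<close>
    by (rule exI[of _ "exp 2"], rule exI[of _ "1 / 4"], rule exI[of _ "(c + d + 1)\<^sup>2 + 2"],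
      intro conjI allI impI, simp, simp, elim conjE max.boundedE, rule prob_max_backyard_gt_le)
qed

end
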